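(* Let $X$ be a topological space of countable tightness. Then each $\sigma$-convex subset $\mathcal F\subset SC_p(X)$ has decomposition number $\mathrm{dec}(\mathcal F)\le hl(X)$.
   Context: A function $f:X\to Y$ between topological spaces is scatteredly continuous if for each non-empty subspace $A\subset X$ the restriction $f|A:A\to Y$ has a point of continuity. $SC_p(X)\subset\mathbb R^X$ denotes the linear space of all scatteredly continuous real-valued functions on $X$, endowed with the topology of pointwise convergence. A subset $C$ of a linear topological space $L$ is $\sigma$-convex if for any sequence $(x_n)_{n\in\omega}$ in $C$ and any sequence of positive real numbers $(t_n)_{n\in\omega}$ with $\sum_{n=0}^\infty t_n=1$ the series $\sum_{n=0}^\infty t_nx_n$ converges to some point $c\in C$. The decomposition number $\mathrm{dec}(\mathcal F)$ of a family $\mathcal F$ of functions on $X$ is the smallest cardinality $|\mathcal C|$ of a cover $\mathcal C$ of $X$ (by arbitrary subsets) such that for each $C\in\mathcal C$ and $f\in\mathcal F$ the restriction $f|C$ is continuous. The tightness $t(X)$ is the smallest infinite cardinal $\kappa$ such that for each $A\subset X$ and $a\in\bar A$ there is $B\subset A$ with $|B|\le\kappa$ and $a\in\bar B$; $X$ has countable tightness if $t(X)=\aleph_0$. The Lindelöf number $l(X)$ is the smallest infinite cardinal $\kappa$ such that each open cover of $X$ has a subcover of cardinality $\le\kappa$; the hereditary Lindelöf number is $hl(X)=\sup\{l(Z):Z\subset X\}$. *)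

theory Defs
  imports "HOL-Analysis.Analysis"
begin

unbundle cardinal_syntax

definition scatteredly_continuous :: "'a topology \<Rightarrow> 'b topology \<Rightarrow> ('a \<Rightarrow> 'b) \<Rightarrow> bool" where
  "scatteredly_continuous X Y f \<longleftrightarrow>
     f \<in> topspace X \<rightarrow> topspace Y \<and>
     (\<forall>A. A \<subseteq> topspace X \<and> A \<noteq> {} \<longrightarrow>
        (\<exists>x\<in>A. topcontinuous_at (subtopology X A) Y f x))"

(* Functions on X are represented by functions that are extensional on topspace X;
   powertop_real (topspace X) is then the power of the real line indexed by X. *)
definition SCp :: "'a topology \<Rightarrow> ('a \<Rightarrow> real) topology" where
  "SCp X = subtopology (powertop_real (topspace X))
             {f. scatteredly_continuous X euclideanreal f}"

(* Sigma-convexity in the linear topological space SCp X. The restriction makes the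
   pointwise partial sums extensional, as the elements of the space are. *)
definition sigma_convex_SCp :: "'a topology \<Rightarrow> ('a \<Rightarrow> real) set \<Rightarrow> bool" where
  "sigma_convex_SCp X C \<longleftrightarrow>
     (\<forall>(f :: nat \<Rightarrow> 'a \<Rightarrow> real) (t :: nat \<Rightarrow> real).
        (\<forall>n. f n \<in> C) \<and> (\<forall>n. 0 < t n) \<and> t sums 1 \<longrightarrow>
        (\<exists>c\<in>C. limitin (SCp X)
                 (\<lambda>n. \<lambda>x\<in>topspace X. \<Sum>i<n. t i * f i x) c sequentially))"

(* Cardinals are represented by cardinal orders (relations r with Card_order r), compared
   by \<le>o. The least element is determined up to =o only. *)
definition least_card :: "'b rel set \<Rightarrow> 'b rel" where
  "least_card K = (SOME r. r \<in> K \<and> (\<forall>s\<in>K. r \<le>o s))"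

lemma least_card:
  assumes "K \<noteq> {}" and "\<And>r. r \<in> K \<Longrightarrow> Card_order r"
  shows "least_card K \<in> K" and "s \<in> K \<Longrightarrow> least_card K \<le>o s"
proof -
  have "\<exists>r. r \<in> K \<and> (\<forall>s\<in>K. r \<le>o s)"
    using exists_minim_Card_order[of K] assms by blast
  then have *: "least_card K \<in> K \<and> (\<forall>s\<in>K. least_card K \<le>o s)"
    unfolding least_card_def by (rule someI_ex)
  show "least_card K \<in> K" using * by blast
  show "s \<in> K \<Longrightarrow> least_card K \<le>o s" using * by blast
qed

definition dec_covers :: "'a topology \<Rightarrow> ('a \<Rightarrow> real) set \<Rightarrow> 'a set set set" where
  "dec_covers X F =
     {\<C>. \<Union>\<C> = topspace X \<and>
          (\<forall>C\<in>\<C>. \<forall>f\<in>F. continuous_map (subtopology X C) euclideanreal f)}"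

definition dec :: "'a topology \<Rightarrow> ('a \<Rightarrow> real) set \<Rightarrow> 'a set rel" where
  "dec X F = least_card (card_of ` dec_covers X F)"

lemma dec_covers_nonempty: "dec_covers X F \<noteq> {}"
proof -
  have "continuous_map (subtopology X {x}) euclideanreal f" for x f
    unfolding continuous_map_def
  proof (intro conjI allI impI)
    fix U :: "real set"
    let ?S = "{y \<in> topspace (subtopology X {x}). f y \<in> U}"
    have "?S = {} \<or> ?S = topspace (subtopology X {x})" by auto
    then show "openin (subtopology X {x}) ?S"
      by (elim disjE) (simp_all only: openin_empty openin_topspace)
  qed simp
  then have "(\<lambda>x. {x}) ` topspace X \<in> dec_covers X F"
    unfolding dec_covers_def by blast
  then show ?thesis by blast
qed

(* The type 'a set + nat is infinite and at least as large as every family of subsets of X,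
   so the cardinals occurring in the following minima and suprema are all represented on it. *)
type_synonym 'a cardinal = "('a set + nat) rel"

definition lindelof_number :: "'a topology \<Rightarrow> 'a cardinal" where
  "lindelof_number X = least_card
     {\<kappa>. Cinfinite \<kappa> \<and>
          (\<forall>\<U>. (\<forall>U\<in>\<U>. openin X U) \<and> \<Union>\<U> = topspace X \<longrightarrow>
               (\<exists>\<V>\<subseteq>\<U>. \<Union>\<V> = topspace X \<and> |\<V>| \<le>o \<kappa>))}"

(* The supremum of a set of cardinals is its least upper bound among the cardinals. *)
definition hereditary_lindelof_number :: "'a topology \<Rightarrow> 'a cardinal" where
  "hereditary_lindelof_number X = least_card
     {\<kappa>. Card_order \<kappa> \<and>
          (\<forall>Z\<subseteq>topspace X. lindelof_number (subtopology X Z) \<le>o \<kappa>)}"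

definition tightness :: "'a topology \<Rightarrow> 'a cardinal" where
  "tightness X = least_card
     {\<kappa>. Cinfinite \<kappa> \<and>
          (\<forall>A a. A \<subseteq> topspace X \<and> a \<in> X closure_of A \<longrightarrow>
               (\<exists>B\<subseteq>A. |B| \<le>o \<kappa> \<and> a \<in> X closure_of B))}"

definition countable_tightness :: "'a topology \<Rightarrow> bool" where
  "countable_tightness X \<longleftrightarrow> tightness X =o natLeq"

lemma Cinfinite_UNIV_cardinal: "Cinfinite |UNIV :: ('a set + nat) set|"
proof
  show "cinfinite |UNIV :: ('a set + nat) set|"
    unfolding cinfinite_def Field_card_of by simp
qed (rule card_of_Card_order)

lemma card_of_le_UNIV_cardinal:
  fixes \<V> :: "'a set set" and B :: "'a set"
  shows "|\<V>| \<le>o |UNIV :: ('a set + nat) set|" and "|B| \<le>o |UNIV :: ('a set + nat) set|"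
proof -
  have "inj_on (Inl :: 'a set \<Rightarrow> 'a set + nat) \<V>" by simp
  then show "|\<V>| \<le>o |UNIV :: ('a set + nat) set|"
    using card_of_ordLeq[of \<V> "UNIV :: ('a set + nat) set"] by blast
  have "inj_on (\<lambda>x. Inl {x} :: 'a set + nat) B" by (simp add: inj_on_def)
  then show "|B| \<le>o |UNIV :: ('a set + nat) set|"
    using card_of_ordLeq[of B "UNIV :: ('a set + nat) set"] by blast
qed

lemma lindelof_number_set_nonempty:
  fixes X :: "'a topology"
  shows "|UNIV :: ('a set + nat) set| \<in>
     {\<kappa>. Cinfinite \<kappa> \<and>
          (\<forall>\<U>. (\<forall>U\<in>\<U>. openin X U) \<and> \<Union>\<U> = topspace X \<longrightarrow>
               (\<exists>\<V>\<subseteq>\<U>. \<Union>\<V> = topspace X \<and> |\<V>| \<le>o \<kappa>))}"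
proof (intro CollectI conjI allI impI)
  fix \<U> assume "(\<forall>U\<in>\<U>. openin X U) \<and> \<Union>\<U> = topspace X"
  then show "\<exists>\<V>\<subseteq>\<U>. \<Union>\<V> = topspace X \<and> |\<V>| \<le>o |UNIV :: ('a set + nat) set|"
    by (intro exI[of _ \<U>] conjI card_of_le_UNIV_cardinal(1)) simp_all
qed (rule Cinfinite_UNIV_cardinal[THEN conjunct1] Cinfinite_UNIV_cardinal[THEN conjunct2])+

lemma hereditary_lindelof_number_set_nonempty:
  fixes X :: "'a topology"
  shows "|UNIV :: ('a set + nat) set| \<in>
     {\<kappa>. Card_order \<kappa> \<and>
          (\<forall>Z\<subseteq>topspace X. lindelof_number (subtopology X Z) \<le>o \<kappa>)}"
proof (intro CollectI conjI allI impI)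
  fix Z
  show "lindelof_number (subtopology X Z) \<le>o |UNIV :: ('a set + nat) set|"
    unfolding lindelof_number_def
  proof (rule least_card(2)[OF _ _ lindelof_number_set_nonempty])
    show "{\<kappa> :: 'a cardinal. Cinfinite \<kappa> \<and>
            (\<forall>\<U>. (\<forall>U\<in>\<U>. openin (subtopology X Z) U) \<and>
                 \<Union>\<U> = topspace (subtopology X Z) \<longrightarrow>
                 (\<exists>\<V>\<subseteq>\<U>. \<Union>\<V> = topspace (subtopology X Z) \<and> |\<V>| \<le>o \<kappa>))} \<noteq> {}"
      using lindelof_number_set_nonempty[of "subtopology X Z"] by (rule ex_in_conv[THEN iffD1, OF exI])
  qed (elim CollectE conjE, assumption)
qed (rule card_of_Card_order)

lemma tightness_set_nonempty:
  fixes X :: "'a topology"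
  shows "|UNIV :: ('a set + nat) set| \<in>
     {\<kappa>. Cinfinite \<kappa> \<and>
          (\<forall>A a. A \<subseteq> topspace X \<and> a \<in> X closure_of A \<longrightarrow>
               (\<exists>B\<subseteq>A. |B| \<le>o \<kappa> \<and> a \<in> X closure_of B))}"
proof (intro CollectI conjI allI impI)
  fix A a assume "A \<subseteq> topspace X \<and> a \<in> X closure_of A"
  then show "\<exists>B\<subseteq>A. |B| \<le>o |UNIV :: ('a set + nat) set| \<and> a \<in> X closure_of B"
    by (intro exI[of _ A] conjI card_of_le_UNIV_cardinal(2)) simp_all
qed (rule Cinfinite_UNIV_cardinal[THEN conjunct1] Cinfinite_UNIV_cardinal[THEN conjunct2])+

end

theory Submission
  imports Defs "HOL-Library.Countable_Set_Type"
begin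

text \<open>A \<open>\<sigma>\<close>-convex set \<open>F\<close> is pointwise bounded, so \<open>X\<close> splits into countably many pieces on which
  \<open>F\<close> is uniformly bounded. If on some non-empty subspace \<open>Y\<close> of a piece every point were a
  discontinuity point of some member of \<open>F\<close>, countable tightness would yield a countable \<open>Q \<subseteq> Y\<close> and
  countably many members of \<open>F\<close>, one discontinuous on \<open>Q\<close> at each point of \<open>Q\<close>; a suitable infinite
  convex combination of them lies in \<open>F\<close> but is discontinuous everywhere on \<open>Q\<close>. Hence every
  non-empty subspace of a piece has a common continuity point, and therefore a non-empty relatively
  open subset on which all of \<open>F\<close> is continuous. The union of all open sets whose trace on the piece
  decomposes into at most \<open>hl(X)\<close> parts is again such a set, by the Lindelof property, so it must
  contain the whole piece.\<close>

section \<open>Continuity in terms of closures\<close>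

text \<open>Turns discontinuity at \<open>x\<close> into membership in a closure, the form to which
  countable tightness applies. The closure is taken in \<open>X\<close> rather than in the subspace,
  so that monotonicity of closures compares different subspaces \<open>A\<close>.\<close>

lemma topcontinuous_at_real_iff:
  assumes "A \<subseteq> topspace X" "x \<in> A"
  shows "topcontinuous_at (subtopology X A) euclideanreal f x \<longleftrightarrow>
    (\<forall>e>0. x \<notin> X closure_of {y\<in>A. e \<le> \<bar>f y - f x\<bar>})" (is "?L \<longleftrightarrow> ?R")
proof
  assume L: ?L
  show ?R
  proof (intro allI impI notI)
    fix e :: real
    assume e: "e > 0" and cl: "x \<in> X closure_of {y\<in>A. e \<le> \<bar>f y - f x\<bar>}"
    have "open (ball (f x) e)" "f x \<in> ball (f x) e" using e by auto
    then obtain U where U: "openin (subtopology X A) U" "x \<in> U" "\<forall>y\<in>U. f y \<in> ball (f x) e"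
      using L unfolding topcontinuous_at_def by (metis open_openin)
    then obtain T where T: "openin X T" "U = T \<inter> A"
      by (auto simp: openin_subtopology)
    then obtain y where "y \<in> T" "y \<in> A" "e \<le> \<bar>f y - f x\<bar>"
      using cl U unfolding in_closure_of by blast
    then show False using U(3) T(2) by (force simp: dist_real_def abs_minus_commute)
  qed
next
  assume R: ?R
  show ?L
    unfolding topcontinuous_at_def
  proof (intro conjI allI impI)
    show "x \<in> topspace (subtopology X A)" using assms by auto
    show "f \<in> topspace (subtopology X A) \<rightarrow> topspace euclideanreal" by simp
    fix V assume "openin euclideanreal V \<and> f x \<in> V"
    then obtain e where e: "e > 0" "ball (f x) e \<subseteq> V"
      by (metis open_openin open_contains_ball)
    then have "x \<notin> X closure_of {y\<in>A. e \<le> \<bar>f y - f x\<bar>}" using R by blast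
    then obtain T where T: "openin X T" "x \<in> T" "\<forall>y\<in>T. y \<in> A \<longrightarrow> \<not> e \<le> \<bar>f y - f x\<bar>"
      using assms unfolding in_closure_of by blast
    show "\<exists>U. openin (subtopology X A) U \<and> x \<in> U \<and> (\<forall>y\<in>U. f y \<in> V)"
    proof (intro exI conjI)
      show "openin (subtopology X A) (T \<inter> A)" using T by (auto simp: openin_subtopology)
      show "x \<in> T \<inter> A" using T assms by simp
      have "f y \<in> ball (f x) e" if "y \<in> T \<inter> A" for y
        using T that by (force simp: dist_real_def abs_minus_commute)
      then show "\<forall>y\<in>T \<inter> A. f y \<in> V" using e by blast
    qed
  qed
qed

lemma countable_tightnessD:
  assumes "countable_tightness X" "A \<subseteq> topspace X" "a \<in> X closure_of A"
  obtains B where "B \<subseteq> A" "countable B" "a \<in> X closure_of B"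
proof -
  let ?K = "{\<kappa> :: 'a cardinal. Cinfinite \<kappa> \<and>
          (\<forall>A a. A \<subseteq> topspace X \<and> a \<in> X closure_of A \<longrightarrow>
               (\<exists>B\<subseteq>A. |B| \<le>o \<kappa> \<and> a \<in> X closure_of B))}"
  have "tightness X \<in> ?K"
    unfolding tightness_def
    by (rule least_card(1)) (use tightness_set_nonempty[of X] in blast)+
  then obtain B where B: "B \<subseteq> A" "|B| \<le>o tightness X" "a \<in> X closure_of B"
    using assms by blast
  then have "|B| \<le>o natLeq"
    using assms(1) unfolding countable_tightness_def by (metis ordLeq_ordIso_trans)
  then have "countable B" by (simp add: countable_card_le_natLeq)
  with B that show thesis by blast
qed

section \<open>Sigma-convex sets of scatteredly continuous functions\<close>

lemma sigma_convex_SCpE: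
  assumes "sigma_convex_SCp X C" "\<And>n. f n \<in> C" "\<And>n. 0 < t n" "t sums 1"
  obtains c where "c \<in> C" "\<And>x. x \<in> topspace X \<Longrightarrow> (\<lambda>i. t i * f i x) sums c x"
proof -
  obtain c where c: "c \<in> C"
      "limitin (SCp X) (\<lambda>n. \<lambda>x\<in>topspace X. \<Sum>i<n. t i * f i x) c sequentially"
    using assms unfolding sigma_convex_SCp_def by blast
  have "(\<lambda>i. t i * f i x) sums c x" if "x \<in> topspace X" for x
    using c(2) that unfolding SCp_def limitin_subtopology limitin_componentwise sums_def
    by simp
  with c that show thesis by blast
qed

text \<open>If the values at \<open>x\<close> were unbounded, members with |f n x| at least 2^(n+1),
  weighted by 2^-(n+1), would form a series whose terms at \<open>x\<close> do not tend to 0,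
  although \<sigma>-convexity makes it converge.\<close>

lemma sigma_convex_SCp_bounded:
  assumes "sigma_convex_SCp X C" "x \<in> topspace X"
  shows "\<exists>k::nat. \<forall>f\<in>C. \<bar>f x\<bar> \<le> real k"
proof (rule ccontr)
  assume "\<not> ?thesis"
  then have "\<not> (\<forall>f\<in>C. \<bar>f x\<bar> \<le> real (2 ^ Suc n))" for n by blast
  then have "\<exists>f\<in>C. 2 ^ Suc n \<le> \<bar>f x\<bar>" for n :: nat
    by (metis linorder_le_cases of_nat_numeral of_nat_power)
  then obtain f where f: "\<And>n. f n \<in> C" "\<And>n::nat. 2 ^ Suc n \<le> \<bar>f n x\<bar>" by metis
  obtain c where "\<And>y. y \<in> topspace X \<Longrightarrow> (\<lambda>i. (1/2) ^ Suc i * f i y) sums c y"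
    by (rule sigma_convex_SCpE[of X C f, OF assms(1) f(1) _ power_half_series]) auto
  then have "(\<lambda>i. (1/2) ^ Suc i * f i x) sums c x" using assms(2) .
  then have "(\<lambda>i. (1/2) ^ Suc i * f i x) \<longlonglongrightarrow> 0"
    using sums_summable summable_LIMSEQ_zero by blast
  then have "\<forall>\<^sub>F i in sequentially. \<bar>(1/2) ^ Suc i * f i x\<bar> < 1"
    using tendstoD[OF _ zero_less_one] by (fastforce simp only: dist_real_def diff_0_right)
  then obtain i where i: "\<bar>(1/2) ^ Suc i * f i x\<bar> < 1"
    by (auto simp: eventually_sequentially)
  have "1 = (1/2) ^ Suc i * (2::real) ^ Suc i" by (metis power_mult_distrib power_one
      nonzero_eq_divide_eq zero_neq_numeral)
  also have "\<dots> \<le> (1/2) ^ Suc i * \<bar>f i x\<bar>" by (intro mult_left_mono f) simp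
  finally show False using i by (simp add: abs_mult)
qed

text \<open>Of the two weights \<open>\<eta> n\<close> and \<open>\<eta> n / 2\<close> at least one makes the partial sum jump at \<open>q n\<close>
  by \<open>\<eta> n * e n / 4\<close>, a size that does not depend on the previous choices; so \<open>\<eta> (Suc n)\<close> can be
  fixed in advance so small that the remaining summands do not destroy the jump.\<close>

lemma discontinuous_series:
  fixes f :: "nat \<Rightarrow> 'a \<Rightarrow> real"
  assumes "\<And>n. q n \<in> Q" and bound: "\<And>n x. x \<in> Q \<Longrightarrow> \<bar>f n x\<bar> \<le> K"
    and e: "\<And>n. 0 < e n" and jump: "\<And>n. q n \<in> X closure_of {x\<in>Q. e n \<le> \<bar>f n x - f n (q n)\<bar>}"
  obtains s where "\<forall>n. 0 < s n" "summable s"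
    "\<forall>h. (\<forall>x\<in>Q. (\<lambda>i. s i * f i x) sums h x) \<longrightarrow>
      (\<forall>n. \<exists>d>0. q n \<in> X closure_of {x\<in>Q. d \<le> \<bar>h x - h (q n)\<bar>})"
proof -
  define K' where "K' = max K 1"
  have K': "K' > 0" "\<And>n x. x \<in> Q \<Longrightarrow> \<bar>f n x\<bar> \<le> K'"
    using bound unfolding K'_def by (auto simp: le_max_iff_disj)
  \<comment> \<open>The factor 32 is used up as follows: the tail after step \<open>n\<close>
    changes the value at one point by at most \<open>2 * K' * \<eta> (Suc n)\<close>, so a
    difference of two values changes by at most half of the jump
    \<open>\<eta> n * e n / 4\<close>.\<close>
  define \<eta> where "\<eta> = rec_nat 1 (\<lambda>n r. min (r / 2) (r * e n / (32 * K')))"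
  have \<eta>0: "\<eta> 0 = 1" and \<eta>S: "\<eta> (Suc n) = min (\<eta> n / 2) (\<eta> n * e n / (32 * K'))" for n
    by (simp_all add: \<eta>_def)
  have \<eta>pos: "0 < \<eta> n" for n
    by (induction n) (use e K'(1) in \<open>simp_all add: \<eta>0 \<eta>S\<close>)
  have \<eta>half: "\<eta> (Suc n) \<le> \<eta> n / 2" for n by (simp add: \<eta>S)
  have \<eta>small: "4 * K' * \<eta> (Suc n) \<le> \<eta> n * e n / 8" for n
  proof -
    have "\<eta> (Suc n) \<le> \<eta> n * e n / (32 * K')" by (simp add: \<eta>S)
    then show ?thesis using K'(1) by (simp add: field_simps)
  qed
  define J where "J n u \<longleftrightarrow> q n \<in> X closure_of {x\<in>Q. \<eta> n * e n / 4 \<le> \<bar>u x - u (q n)\<bar>}"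
    for n and u :: "'a \<Rightarrow> real"
  define w where "w n u = (if J n (\<lambda>x. u x + \<eta> n * f n x) then \<eta> n else \<eta> n / 2)" for n u
  \<comment> \<open>The recursion runs on the partial sums, because the choice of the next weight
    needs the partial sum so far; the weights \<open>s\<close> are read off afterwards.\<close>
  define g where "g = rec_nat (\<lambda>x. 0) (\<lambda>n u x. u x + w n u * f n x)"
  define s where "s n = w n (g n)" for n
  have g0: "g 0 = (\<lambda>x. 0)" and gS: "g (Suc n) = (\<lambda>x. g n x + s n * f n x)" for n
    by (simp_all add: g_def s_def)
  have gsum: "g n x = (\<Sum>i<n. s i * f i x)" for n x
    by (induction n) (simp_all add: g0 gS)
  have s: "0 < s n" "s n \<le> \<eta> n" for n
    using \<eta>pos[of n] by (auto simp: s_def w_def)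
  have \<eta>le: "\<eta> n \<le> (1/2) ^ n" for n
  proof (induction n)
    case (Suc n) then show ?case using \<eta>half[of n] by simp
  qed (simp add: \<eta>0)
  have summ: "summable s"
    by (rule summable_comparison_test'[OF summable_geometric[of "1/2::real"], of 0])
      (use s \<eta>le order_trans in \<open>fastforce simp: less_imp_le\<close>)+
  have Jg: "J n (g (Suc n))" for n
  proof (cases "J n (\<lambda>x. g n x + \<eta> n * f n x)")
    case True then show ?thesis by (simp add: gS s_def w_def)
  next
    case False
    let ?u = "\<lambda>x. g n x + \<eta> n * f n x" and ?v = "\<lambda>x. g n x + \<eta> n / 2 * f n x"
    let ?S = "\<lambda>u. {x\<in>Q. \<eta> n * e n / 4 \<le> \<bar>u x - u (q n)\<bar>}"
    \<comment> \<open>The increments of \<open>?u\<close> and \<open>?v\<close> between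
      \<open>q n\<close> and \<open>x\<close> differ by half of \<open>\<eta> n\<close> times that
      of \<open>f n\<close>, hence by at least \<open>\<eta> n * e n / 2\<close>; so one of them is
      at least \<open>\<eta> n * e n / 4\<close>. As closure commutes with finite unions, one of the
      two sets accumulates at \<open>q n\<close>.\<close>
    have "{x\<in>Q. e n \<le> \<bar>f n x - f n (q n)\<bar>} \<subseteq> ?S ?u \<union> ?S ?v"
    proof (intro subsetI UnCI)
      fix x assume "x \<in> {x\<in>Q. e n \<le> \<bar>f n x - f n (q n)\<bar>}" and v: "x \<notin> ?S ?v"
      then have xQ: "x \<in> Q" and x: "e n \<le> \<bar>f n x - f n (q n)\<bar>" by blast+
      from v xQ have v': "\<not> \<eta> n * e n / 4 \<le> \<bar>?v x - ?v (q n)\<bar>" by blast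
      have "\<eta> n * e n \<le> \<eta> n * \<bar>f n x - f n (q n)\<bar>" using x \<eta>pos[of n] by simp
      also have "\<dots> = \<bar>\<eta> n * f n x - \<eta> n * f n (q n)\<bar>"
        using \<eta>pos[of n] by (simp add: right_diff_distrib[symmetric] abs_mult)
      finally have "\<eta> n * e n / 4 \<le> \<bar>?u x - ?u (q n)\<bar>"
        using v' by argo
      then show "x \<in> ?S ?u" using xQ by blast
    qed
    then have "q n \<in> X closure_of (?S ?u \<union> ?S ?v)"
      using jump[of n] closure_of_mono by blast
    then have "J n ?v" using False by (simp add: closure_of_Un J_def)
    then show ?thesis using False by (simp add: gS s_def w_def)
  qed
  \<comment> \<open>Halving gives \<open>\<eta> k \<le> 2 * (\<eta> k - \<eta> (Suc k))\<close>, so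
    the bounds on the single summands telescope.\<close>
  have tail: "\<bar>g (m + N) x - g m x\<bar> \<le> 2 * K' * (\<eta> m - \<eta> (m + N))" if x: "x \<in> Q" for m N x
  proof (induction N)
    case (Suc N)
    have "\<bar>s (m + N) * f (m + N) x\<bar> \<le> \<eta> (m + N) * K'"
      unfolding abs_mult by (intro mult_mono) (use s[of "m+N"] \<eta>pos[of "m+N"] K'(2)[OF x] in auto)
    also have "\<dots> \<le> 2 * K' * (\<eta> (m + N) - \<eta> (Suc (m + N)))"
      using mult_left_mono[OF \<eta>half[of "m+N"], of "2*K'"] K'(1) by (simp add: algebra_simps)
    finally show ?case using Suc by (simp add: gS algebra_simps)
  qed simp
  show thesis
  proof (rule that[OF allI[OF s(1)] summ], intro allI impI)
    fix h n
    assume h: "\<forall>x\<in>Q. (\<lambda>i. s i * f i x) sums h x"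
    let ?d = "\<eta> n * e n / 8"
    have close: "\<bar>h x - g (Suc n) x\<bar> \<le> 2 * K' * \<eta> (Suc n)" if x: "x \<in> Q" for x
    proof -
      have "(\<lambda>N. g N x) \<longlonglongrightarrow> h x" using h x by (simp add: sums_def gsum)
      then have "(\<lambda>N. g (Suc n + N) x) \<longlonglongrightarrow> h x"
        using LIMSEQ_ignore_initial_segment[of _ _ "Suc n"] by (simp add: add.commute)
      then have "(\<lambda>N. \<bar>g (Suc n + N) x - g (Suc n) x\<bar>) \<longlonglongrightarrow> \<bar>h x - g (Suc n) x\<bar>"
        by (intro tendsto_intros)
      moreover have "\<bar>g (Suc n + N) x - g (Suc n) x\<bar> \<le> 2 * K' * \<eta> (Suc n)" for N
        by (rule order_trans[OF tail[OF x]]) (use K'(1) \<eta>pos[of "Suc n + N"] in simp)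
      ultimately show ?thesis by (intro LIMSEQ_le_const2) auto
    qed
    have "{x\<in>Q. \<eta> n * e n / 4 \<le> \<bar>g (Suc n) x - g (Suc n) (q n)\<bar>} \<subseteq> {x\<in>Q. ?d \<le> \<bar>h x - h (q n)\<bar>}"
    proof clarify
      fix x assume "x \<in> Q" "\<eta> n * e n / 4 \<le> \<bar>g (Suc n) x - g (Suc n) (q n)\<bar>"
      then show "?d \<le> \<bar>h x - h (q n)\<bar>"
        using close[of x] close[OF assms(1)[of n]] \<eta>small[of n] by argo
    qed
    then have "q n \<in> X closure_of {x\<in>Q. ?d \<le> \<bar>h x - h (q n)\<bar>}"
      using Jg[of n] closure_of_mono unfolding J_def by blast
    moreover have "?d > 0" using e \<eta>pos by simp
    ultimately show "\<exists>d>0. q n \<in> X closure_of {x\<in>Q. d \<le> \<bar>h x - h (q n)\<bar>}" by blast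
  qed
qed

text \<open>Countably many rounds of adding the sets \<open>B a\<close> suffice. Applied to
  countable witnesses of discontinuity, this gives a countable subspace on which all the chosen
  discontinuities persist.\<close>

lemma countable_closed_under:
  assumes "\<And>a. a \<in> Y \<Longrightarrow> countable (B a) \<and> B a \<subseteq> Y" "y \<in> Y"
  shows "\<exists>Q. countable Q \<and> y \<in> Q \<and> Q \<subseteq> Y \<and> (\<forall>a\<in>Q. B a \<subseteq> Q)"
proof -
  define S where "S n = ((\<lambda>T. \<Union>a\<in>T. B a) ^^ n) {y}" for n
  have S: "countable (S n) \<and> S n \<subseteq> Y" for n
  proof (induction n)
    case (Suc n)
    have "S (Suc n) = (\<Union>a\<in>S n. B a)" by (simp add: S_def)
    then show ?case using Suc assms(1) by (auto intro!: countable_UN)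
  qed (use assms in \<open>simp add: S_def\<close>)
  show ?thesis
  proof (intro exI conjI ballI)
    show "countable (\<Union>n. S n)" using S by blast
    show "y \<in> (\<Union>n. S n)" by (rule UN_I[of 0]) (simp_all add: S_def)
    show "(\<Union>n. S n) \<subseteq> Y" using S by blast
    fix a assume "a \<in> (\<Union>n. S n)"
    then obtain n where "a \<in> S n" by blast
    then have "B a \<subseteq> S (Suc n)" by (auto simp: S_def)
    then show "B a \<subseteq> (\<Union>n. S n)" by blast
  qed
qed

text \<open>Scattered continuity is applied to a single function, an infinite convex combination in
  \<open>F\<close>, on a single countable subspace \<open>Q\<close> where it was built to have no
  continuity point.\<close>

lemma sigma_convex_common_continuity_point:
  assumes "countable_tightness X" "F \<subseteq> topspace (SCp X)" "sigma_convex_SCp X F"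
    and Y: "Y \<subseteq> topspace X" "Y \<noteq> {}" and bound: "\<And>f x. f \<in> F \<Longrightarrow> x \<in> Y \<Longrightarrow> \<bar>f x\<bar> \<le> K"
  shows "\<exists>x\<in>Y. \<forall>f\<in>F. topcontinuous_at (subtopology X Y) euclideanreal f x"
proof (rule ccontr)
  assume contra: "\<not> ?thesis"
  define P where "P a f e B \<longleftrightarrow> f \<in> F \<and> e > 0 \<and> countable B \<and>
      B \<subseteq> {y\<in>Y. e \<le> \<bar>f y - f a\<bar>} \<and> a \<in> X closure_of B" for a f B and e :: real
  have "\<exists>f e B. P a f e B"
    if a: "a \<in> Y" for a
  proof -
    obtain f e where fe: "f \<in> F" "e > 0" "a \<in> X closure_of {y\<in>Y. e \<le> \<bar>f y - f a\<bar>}"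
      using contra a topcontinuous_at_real_iff[OF Y(1) a] by blast
    have "{y\<in>Y. e \<le> \<bar>f y - f a\<bar>} \<subseteq> topspace X" using Y by blast
    then obtain B where "B \<subseteq> {y\<in>Y. e \<le> \<bar>f y - f a\<bar>}" "countable B" "a \<in> X closure_of B"
      using countable_tightnessD[OF assms(1) _ fe(3)] by metis
    with fe show ?thesis unfolding P_def by blast
  qed
  then obtain f e B where P: "\<And>a. a \<in> Y \<Longrightarrow> P a (f a) (e a) (B a)"
    by metis
  then have fe: "\<And>a. a \<in> Y \<Longrightarrow> f a \<in> F" "\<And>a. a \<in> Y \<Longrightarrow> e a > 0"
    and B: "\<And>a. a \<in> Y \<Longrightarrow> countable (B a)" "\<And>a. a \<in> Y \<Longrightarrow> a \<in> X closure_of (B a)"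
      "\<And>a. a \<in> Y \<Longrightarrow> B a \<subseteq> {y\<in>Y. e a \<le> \<bar>f a y - f a a\<bar>}"
    unfolding P_def by blast+
  have BY: "countable (B a) \<and> B a \<subseteq> Y" if "a \<in> Y" for a
    using B(1,3)[OF that] by blast
  obtain y where "y \<in> Y" using Y by blast
  obtain Q where Q: "countable Q" "y \<in> Q" "Q \<subseteq> Y" "\<And>a. a \<in> Q \<Longrightarrow> B a \<subseteq> Q"
    using countable_closed_under[of Y B y, OF BY \<open>y \<in> Y\<close>] by blast
  \<comment> \<open>The enumeration may repeat points, for instance when \<open>Q\<close> is finite;
    only its surjectivity onto \<open>Q\<close> matters.\<close>
  define q where "q = from_nat_into Q"
  have q: "q n \<in> Q" "q n \<in> Y" for n
    using Q from_nat_into[of Q n] unfolding q_def by blast+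
  have jump: "q n \<in> X closure_of {x\<in>Q. e (q n) \<le> \<bar>f (q n) x - f (q n) (q n)\<bar>}" for n
  proof -
    have "B (q n) \<subseteq> {x\<in>Q. e (q n) \<le> \<bar>f (q n) x - f (q n) (q n)\<bar>}"
      using B(3)[OF q(2)] Q(4)[OF q(1)] by blast
    then show ?thesis using B(2)[OF q(2)] closure_of_mono by blast
  qed
  have bd: "\<bar>f (q n) x\<bar> \<le> K" if "x \<in> Q" for n x
    using bound fe(1) q(2) that Q(3) by blast
  obtain s where s: "\<forall>n. 0 < s n" "summable s"
    "\<forall>h. (\<forall>x\<in>Q. (\<lambda>i. s i * f (q i) x) sums h x) \<longrightarrow>
      (\<forall>n. \<exists>d>0. q n \<in> X closure_of {x\<in>Q. d \<le> \<bar>h x - h (q n)\<bar>})"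
    by (rule discontinuous_series[of q Q "\<lambda>n. f (q n)" K "\<lambda>n. e (q n)" X,
          OF q(1) bd fe(2)[OF q(2)] jump]) (assumption | rule that)+
  \<comment> \<open>The weights \<open>s\<close> need not add up to 1. Dividing by \<open>S\<close>
    makes them admissible for \<sigma>-convexity, and \<open>S * c\<close> is then the sum of the
    original series on \<open>Q\<close>.\<close>
  define S where "S = suminf s"
  have S: "S > 0" unfolding S_def using s by (intro suminf_pos) simp_all
  have "(\<lambda>i. s i / S) sums 1"
    using sums_divide[OF summable_sums[OF s(2)], of S] S by (simp add: S_def)
  then obtain c where c: "c \<in> F" "\<And>x. x \<in> topspace X \<Longrightarrow> (\<lambda>i. s i / S * f (q i) x) sums c x"
    using sigma_convex_SCpE[OF assms(3), of "\<lambda>i. f (q i)" "\<lambda>i. s i / S"] fe(1) q(2) s(1) S by auto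
  have h: "(\<lambda>i. s i * f (q i) x) sums (S * c x)" if "x \<in> Q" for x
    using sums_mult[OF c(2)[of x], of S] that Q(3) Y(1) S by auto
  have "scatteredly_continuous X euclideanreal c"
    using c(1) assms(2) by (auto simp: SCp_def)
  moreover have "Q \<subseteq> topspace X" "Q \<noteq> {}" using Q Y by auto
  ultimately obtain x where x: "x \<in> Q" "topcontinuous_at (subtopology X Q) euclideanreal c x"
    unfolding scatteredly_continuous_def by blast
  obtain n where n: "x = q n"
    using from_nat_into_surj[OF Q(1) x(1)] unfolding q_def by metis
  obtain d where d: "d > 0" "x \<in> X closure_of {y\<in>Q. d \<le> \<bar>S * c y - S * c x\<bar>}"
    using s(3)[rule_format, of "\<lambda>x. S * c x" n] h n by blast
  have "\<bar>S * c y - S * c x\<bar> = S * \<bar>c y - c x\<bar>" for y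
    using S by (simp add: right_diff_distrib[symmetric] abs_mult)
  then have "{y\<in>Q. d \<le> \<bar>S * c y - S * c x\<bar>} = {y\<in>Q. d / S \<le> \<bar>c y - c x\<bar>}"
    using S by (simp add: field_simps)
  then show False
    using d x topcontinuous_at_real_iff[OF \<open>Q \<subseteq> topspace X\<close> x(1)] S by fastforce
qed

text \<open>The set \<open>D\<close> of points of \<open>A\<close> where some member is
  discontinuous on \<open>A\<close> cannot be dense in \<open>A\<close>, so some open
  \<open>U\<close> meets \<open>A\<close> and misses \<open>D\<close>. Density is refuted at a
  common continuity point of the subspace \<open>D\<close> itself.\<close>

lemma common_continuity_open:
  assumes pt: "\<And>Y. Y \<subseteq> A \<Longrightarrow> Y \<noteq> {} \<Longrightarrow>
      \<exists>x\<in>Y. \<forall>f\<in>F. topcontinuous_at (subtopology X Y) euclideanreal f x"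
    and A: "A \<subseteq> topspace X" "A \<noteq> {}"
  obtains U where "openin X U" "U \<inter> A \<noteq> {}"
    "\<And>f. f \<in> F \<Longrightarrow> continuous_map (subtopology X (U \<inter> A)) euclideanreal f"
proof -
  define D where "D = {x\<in>A. \<exists>f\<in>F. \<not> topcontinuous_at (subtopology X A) euclideanreal f x}"
  have "\<not> A \<subseteq> X closure_of D"
  proof
    assume dense: "A \<subseteq> X closure_of D"
    then have "D \<noteq> {}" using A by auto
    then obtain x where x: "x \<in> D" "\<And>f. f \<in> F \<Longrightarrow> topcontinuous_at (subtopology X D) euclideanreal f x"
      using pt[of D] unfolding D_def by blast
    then obtain f where f: "f \<in> F" "\<not> topcontinuous_at (subtopology X A) euclideanreal f x"
      unfolding D_def by blast
    have "x \<in> A" and DX: "D \<subseteq> topspace X" using x(1) A unfolding D_def by auto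
    then obtain e where e: "e > 0" "x \<in> X closure_of {y\<in>A. e \<le> \<bar>f y - f x\<bar>}"
      using f topcontinuous_at_real_iff[OF A(1), of x f] by blast
    have "x \<notin> X closure_of {y\<in>D. e/2 \<le> \<bar>f y - f x\<bar>}"
      using x(2)[OF f(1)] topcontinuous_at_real_iff[OF DX x(1), of f] half_gt_zero[OF e(1)] by blast
    then obtain T where T: "openin X T" "x \<in> T" "\<And>y. y \<in> T \<Longrightarrow> y \<in> D \<Longrightarrow> \<bar>f y - f x\<bar> < e/2"
      using DX x(1) unfolding in_closure_of by (auto simp: not_le)
    then obtain y where y: "y \<in> T" "y \<in> A" "e \<le> \<bar>f y - f x\<bar>"
      using e(2) unfolding in_closure_of by blast
    \<comment> \<open>Within \<open>D\<close>, \<open>f\<close> stays within \<open>e/2\<close> of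
      \<open>f x\<close> on \<open>T\<close>, whereas \<open>y\<close> is off by at least
      \<open>e\<close>. So \<open>f\<close> is continuous at \<open>y\<close> on \<open>A\<close>,
      and a point of \<open>D\<close> near \<open>y\<close> has a value within \<open>e/2\<close> of
      both \<open>f x\<close> and \<open>f y\<close>, which is impossible.\<close>
    then have "y \<notin> D" using T(3) e(1) by force
    then have "y \<notin> X closure_of {z\<in>A. e/2 \<le> \<bar>f z - f y\<bar>}"
      using topcontinuous_at_real_iff[OF A(1) y(2), of f] f(1) y(2) half_gt_zero[OF e(1)]
      unfolding D_def by blast
    then obtain W where W: "openin X W" "y \<in> W" "\<And>z. z \<in> W \<Longrightarrow> z \<in> A \<Longrightarrow> \<bar>f z - f y\<bar> < e/2"
      using A y(2) unfolding in_closure_of by (auto simp: not_le)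
    have "openin X (T \<inter> W)" "y \<in> T \<inter> W" using T W y by auto
    moreover have "y \<in> X closure_of D" using dense y by blast
    ultimately obtain z where z: "z \<in> D" "z \<in> T" "z \<in> W"
      unfolding in_closure_of by blast
    then have "\<bar>f z - f x\<bar> < e/2" "\<bar>f z - f y\<bar> < e/2"
      using T(3) W(3) unfolding D_def by auto
    then show False using y(3) by argo
  qed
  then obtain a where a: "a \<in> A" "a \<notin> X closure_of D" by blast
  then obtain U where U: "openin X U" "a \<in> U" "U \<inter> D = {}"
    using A unfolding in_closure_of by blast
  show thesis
  proof (rule that[OF U(1)])
    show "U \<inter> A \<noteq> {}" using a U by blast
    fix f assume f: "f \<in> F"
    have UA: "U \<inter> A \<subseteq> topspace X" using A by blast
    have "topcontinuous_at (subtopology X (U \<inter> A)) euclideanreal f x" if x: "x \<in> U \<inter> A" for x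
    proof -
      have "topcontinuous_at (subtopology X A) euclideanreal f x"
        using x U(3) f unfolding D_def by blast
      then have "\<forall>e>0. x \<notin> X closure_of {y\<in>A. e \<le> \<bar>f y - f x\<bar>}"
        using topcontinuous_at_real_iff[OF A(1), of x f] x by blast
      moreover have "X closure_of {y\<in>U \<inter> A. e \<le> \<bar>f y - f x\<bar>} \<subseteq> X closure_of {y\<in>A. e \<le> \<bar>f y - f x\<bar>}" for e
        by (rule closure_of_mono) blast
      ultimately show ?thesis using topcontinuous_at_real_iff[OF UA x, of f] by blast
    qed
    then show "continuous_map (subtopology X (U \<inter> A)) euclideanreal f"
      unfolding continuous_map_eq_topcontinuous_at by auto
  qed
qed

section \<open>Decompositions and the hereditary Lindelof number\<close>

lemma lindelof_number:
  shows "Cinfinite (lindelof_number X)"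
    and "(\<And>U. U \<in> \<U> \<Longrightarrow> openin X U) \<Longrightarrow> \<Union>\<U> = topspace X \<Longrightarrow>
      \<exists>\<V>\<subseteq>\<U>. \<Union>\<V> = topspace X \<and> |\<V>| \<le>o lindelof_number X"
proof -
  let ?K = "{\<kappa> :: 'a cardinal. Cinfinite \<kappa> \<and>
          (\<forall>\<U>. (\<forall>U\<in>\<U>. openin X U) \<and> \<Union>\<U> = topspace X \<longrightarrow>
               (\<exists>\<V>\<subseteq>\<U>. \<Union>\<V> = topspace X \<and> |\<V>| \<le>o \<kappa>))}"
  have *: "lindelof_number X \<in> ?K"
    unfolding lindelof_number_def
    by (rule least_card(1)) (use lindelof_number_set_nonempty[of X] in blast)+
  then show "Cinfinite (lindelof_number X)" by blast
  show "\<exists>\<V>\<subseteq>\<U>. \<Union>\<V> = topspace X \<and> |\<V>| \<le>o lindelof_number X"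
    if "\<And>U. U \<in> \<U> \<Longrightarrow> openin X U" "\<Union>\<U> = topspace X"
    using * that by blast
qed

lemma hereditary_lindelof_number:
  shows "Cinfinite (hereditary_lindelof_number X)"
    and "Z \<subseteq> topspace X \<Longrightarrow> lindelof_number (subtopology X Z) \<le>o hereditary_lindelof_number X"
proof -
  let ?K = "{\<kappa> :: 'a cardinal. Card_order \<kappa> \<and>
          (\<forall>Z\<subseteq>topspace X. lindelof_number (subtopology X Z) \<le>o \<kappa>)}"
  have *: "hereditary_lindelof_number X \<in> ?K"
    unfolding hereditary_lindelof_number_def
    by (rule least_card(1)) (use hereditary_lindelof_number_set_nonempty[of X] in blast)+
  then show "Z \<subseteq> topspace X \<Longrightarrow> lindelof_number (subtopology X Z) \<le>o hereditary_lindelof_number X"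
    by blast
  \<comment> \<open>Lindelof numbers are infinite by definition, so even the empty subspace forces
    the upper bound to be infinite.\<close>
  from * have "lindelof_number (subtopology X {}) \<le>o hereditary_lindelof_number X" by blast
  then show "Cinfinite (hereditary_lindelof_number X)"
    using * lindelof_number(1) cinfinite_mono by blast
qed

text \<open>The family covers the subspace \<open>\<Union>\<U>\<close>, whose Lindelof number is
  bounded by the hereditary one.\<close>

lemma hereditary_lindelof_subcover:
  assumes "\<And>U. U \<in> \<U> \<Longrightarrow> openin X U"
  obtains \<V> where "\<V> \<subseteq> \<U>" "\<Union>\<V> = \<Union>\<U>" "|\<V>| \<le>o hereditary_lindelof_number X"
proof -
  have sub: "\<Union>\<U> \<subseteq> topspace X" using assms openin_subset by blast
  then have top: "topspace (subtopology X (\<Union>\<U>)) = \<Union>\<U>" by auto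
  have op: "openin (subtopology X (\<Union>\<U>)) U" if "U \<in> \<U>" for U
    using assms[OF that] that by (meson Union_upper openin_subtopology_self subset_openin_subtopology)
  from lindelof_number(2)[of \<U>, OF op top[symmetric]]
  obtain \<V> where \<V>: "\<V> \<subseteq> \<U>" "\<Union>\<V> = \<Union>\<U>" "|\<V>| \<le>o lindelof_number (subtopology X (\<Union>\<U>))"
    unfolding top by auto
  have "|\<V>| \<le>o hereditary_lindelof_number X"
    using \<V>(3) hereditary_lindelof_number(2)[OF sub] by (rule ordLeq_transitive)
  with \<V>(1,2) show thesis by (rule that)
qed

lemma finite_ordLeq_Cinfinite:
  assumes "Cinfinite \<kappa>" "finite A"
  shows "|A| \<le>o \<kappa>"
proof -
  have "BNF_Cardinal_Arithmetic.cfinite |A|" using assms(2) by (simp only: BNF_Cardinal_Arithmetic.cfinite_def Field_card_of)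
  then show ?thesis
    using Cfinite_ordLess_Cinfinite[OF conjI[OF _ card_of_Card_order] assms(1)] ordLess_imp_ordLeq
    by blast
qed

text \<open>A relative form of the bound on \<open>dec\<close>, for an arbitrary subset and a fixed
  \<open>\<kappa>\<close>, so that pieces can be combined by unions.\<close>

definition decomposable :: "'a topology \<Rightarrow> ('a \<Rightarrow> real) set \<Rightarrow> 'b rel \<Rightarrow> 'a set \<Rightarrow> bool" where
  "decomposable X F \<kappa> S \<longleftrightarrow> (\<exists>\<C>. \<Union>\<C> = S \<and> |\<C>| \<le>o \<kappa> \<and>
     (\<forall>C\<in>\<C>. \<forall>f\<in>F. continuous_map (subtopology X C) euclideanreal f))"

text \<open>An infinite cardinal absorbs a union of at most \<open>\<kappa>\<close> families of size
  at most \<open>\<kappa>\<close>.\<close>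

lemma decomposable_UN:
  assumes "Cinfinite \<kappa>" "|I| \<le>o \<kappa>" "\<And>i. i \<in> I \<Longrightarrow> decomposable X F \<kappa> (S i)"
  shows "decomposable X F \<kappa> (\<Union>i\<in>I. S i)"
proof -
  obtain \<C> where \<C>: "\<And>i. i \<in> I \<Longrightarrow> \<Union>(\<C> i) = S i" "\<And>i. i \<in> I \<Longrightarrow> |\<C> i| \<le>o \<kappa>"
    "\<And>i. i \<in> I \<Longrightarrow> \<forall>C\<in>\<C> i. \<forall>f\<in>F. continuous_map (subtopology X C) euclideanreal f"
    using assms(3) unfolding decomposable_def by metis
  have "|\<Union>i\<in>I. \<C> i| \<le>o \<kappa>"
    using assms(1) \<C>(2) unfolding cinfinite_def
    by (intro card_of_UNION_ordLeq_infinite_Field[OF _ _ assms(2)] ballI) blast+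
  moreover have "\<Union>(\<Union>i\<in>I. \<C> i) = (\<Union>i\<in>I. S i)" using \<C>(1) by blast
  moreover have "\<forall>C\<in>(\<Union>i\<in>I. \<C> i). \<forall>f\<in>F. continuous_map (subtopology X C) euclideanreal f"
    using \<C>(3) by blast
  ultimately show ?thesis unfolding decomposable_def by (intro exI conjI)
qed

lemma decomposable_single:
  assumes "Cinfinite \<kappa>" "\<And>f. f \<in> F \<Longrightarrow> continuous_map (subtopology X C) euclideanreal f"
  shows "decomposable X F \<kappa> C"
proof -
  have "|{C}| \<le>o \<kappa>" by (rule finite_ordLeq_Cinfinite[OF assms(1)]) simp
  then show ?thesis using assms(2) unfolding decomposable_def by (intro exI[of _ "{C}"]) auto
qed

lemma decomposable_Un:
  assumes "Cinfinite \<kappa>" "decomposable X F \<kappa> S" "decomposable X F \<kappa> T"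
  shows "decomposable X F \<kappa> (S \<union> T)"
  using decomposable_UN[OF assms(1) finite_ordLeq_Cinfinite[OF assms(1)], of "{S, T}" X F "\<lambda>S. S"]
    assms(2,3) by auto

text \<open>Taking one largest open set \<open>G\<close> replaces a transfinite removal of open
  pieces. The local hypothesis is required for all non-empty subsets of \<open>A\<close> because it
  is applied to the remainder \<open>A - G\<close>.\<close>

lemma decomposable_hereditary_lindelof:
  assumes A: "A \<subseteq> topspace X"
    and loc: "\<And>Y. Y \<subseteq> A \<Longrightarrow> Y \<noteq> {} \<Longrightarrow> \<exists>U. openin X U \<and> U \<inter> Y \<noteq> {} \<and>
      (\<forall>f\<in>F. continuous_map (subtopology X (U \<inter> Y)) euclideanreal f)"
  shows "decomposable X F (hereditary_lindelof_number X) A"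
proof -
  let ?\<kappa> = "hereditary_lindelof_number X"
  note inf = hereditary_lindelof_number(1)[of X]
  define \<G> where "\<G> = {W. openin X W \<and> decomposable X F ?\<kappa> (W \<inter> A)}"
  define G where "G = \<Union>\<G>"
  obtain \<V> where \<V>: "\<V> \<subseteq> \<G>" "\<Union>\<V> = G" "|\<V>| \<le>o ?\<kappa>"
    using hereditary_lindelof_subcover[of \<G> X] unfolding \<G>_def G_def by blast
  have "decomposable X F ?\<kappa> (\<Union>W\<in>\<V>. W \<inter> A)"
    using \<V>(1) unfolding \<G>_def by (intro decomposable_UN[OF inf \<V>(3)]) blast
  moreover have "(\<Union>W\<in>\<V>. W \<inter> A) = G \<inter> A" using \<V>(2) by blast
  ultimately have G: "decomposable X F ?\<kappa> (G \<inter> A)" by simp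
  have "A \<subseteq> G"
  proof (rule ccontr)
    assume "\<not> A \<subseteq> G"
    then obtain U where U: "openin X U" "U \<inter> (A - G) \<noteq> {}"
        "\<And>f. f \<in> F \<Longrightarrow> continuous_map (subtopology X (U \<inter> (A - G))) euclideanreal f"
      using loc[of "A - G"] by blast
    \<comment> \<open>Adding the one new piece found in the remainder shows that
      \<open>G \<union> U\<close> also belongs to \<open>\<G>\<close>, so \<open>U\<close> lies
      inside \<open>G\<close> and cannot meet \<open>A - G\<close>.\<close>
    have "decomposable X F ?\<kappa> ((G \<inter> A) \<union> (U \<inter> (A - G)))"
      using decomposable_Un[OF inf G decomposable_single[OF inf U(3)]] by simp
    moreover have "(G \<inter> A) \<union> (U \<inter> (A - G)) = (G \<union> U) \<inter> A" by blast
    moreover have "openin X (G \<union> U)" using U(1) unfolding G_def \<G>_def by blast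
    ultimately have "G \<union> U \<in> \<G>" unfolding \<G>_def by simp
    then show False using U(2) unfolding G_def by blast
  qed
  then show ?thesis using G by (simp add: Int_absorb1)
qed

lemma dec_le:
  assumes "decomposable X F \<kappa> (topspace X)"
  shows "dec X F \<le>o \<kappa>"
proof -
  obtain \<C> where \<C>: "\<Union>\<C> = topspace X" "|\<C>| \<le>o \<kappa>"
    "\<forall>C\<in>\<C>. \<forall>f\<in>F. continuous_map (subtopology X C) euclideanreal f"
    using assms unfolding decomposable_def by (elim exE conjE) (rule that)
  then have "\<C> \<in> dec_covers X F" unfolding dec_covers_def by simp
  have "dec X F \<le>o |\<C>|"
    unfolding dec_def by (rule least_card(2)) (use \<open>\<C> \<in> dec_covers X F\<close> card_of_Card_order in auto)
  then show ?thesis using \<C>(2) by (rule ordLeq_transitive)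
qed

theorem theorem1:
  fixes X :: "'a topology" and \<F> :: "('a \<Rightarrow> real) set"
  assumes "countable_tightness X"
    and "\<F> \<subseteq> topspace (SCp X)"
    and "sigma_convex_SCp X \<F>"
  shows "dec X \<F> \<le>o hereditary_lindelof_number X"
proof (rule dec_le)
  let ?\<kappa> = "hereditary_lindelof_number X"
  note inf = hereditary_lindelof_number(1)[of X]
  define A where "A k = {x\<in>topspace X. \<forall>f\<in>\<F>. \<bar>f x\<bar> \<le> real k}" for k :: nat
  have "topspace X = (\<Union>k. A k)"
    using sigma_convex_SCp_bounded[OF assms(3)] unfolding A_def by blast
  moreover have "decomposable X \<F> ?\<kappa> (\<Union>k. A k)"
  proof (rule decomposable_UN[OF inf])
    show "|UNIV :: nat set| \<le>o ?\<kappa>"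
      using inf card_of_nat natLeq_ordLeq_cinfinite ordIso_ordLeq_trans by blast
    fix k
    have AX: "A k \<subseteq> topspace X" unfolding A_def by blast
    \<comment> \<open>The uniform bound \<open>real k\<close> on \<open>A k\<close> is inherited by
      every subspace \<open>Y\<close>, so the common continuity point exists in each of
      them.\<close>
    have pt: "\<exists>x\<in>Y. \<forall>f\<in>\<F>. topcontinuous_at (subtopology X Y) euclideanreal f x"
      if "Y \<subseteq> A k" "Y \<noteq> {}" for Y
      by (rule sigma_convex_common_continuity_point[OF assms, of Y "real k"])
        (use that in \<open>auto simp: A_def\<close>)
    show "decomposable X \<F> ?\<kappa> (A k)"
    proof (rule decomposable_hereditary_lindelof[OF AX])
      fix Y assume Y: "Y \<subseteq> A k" "Y \<noteq> {}"
      obtain U where "openin X U" "U \<inter> Y \<noteq> {}"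
          "\<And>f. f \<in> \<F> \<Longrightarrow> continuous_map (subtopology X (U \<inter> Y)) euclideanreal f"
        using common_continuity_open[OF pt[OF subset_trans[OF _ Y(1)]] subset_trans[OF Y(1) AX] Y(2)]
        by metis
      then show "\<exists>U. openin X U \<and> U \<inter> Y \<noteq> {} \<and>
          (\<forall>f\<in>\<F>. continuous_map (subtopology X (U \<inter> Y)) euclideanreal f)" by blast
    qed
  qed
  ultimately show "decomposable X \<F> ?\<kappa> (topspace X)" by simp
qed

end
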